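(* For any delay $\tau>0$, symmetric 1:1-periodic orbits of $$h'(t)=-\operatorname{sign}(h(t-\tau))+c\cos(2\pi t)$$ with phase $\alpha\in[-\tfrac14,\tfrac14]\pmod1$ exist for all $c$ sufficiently large. If in addition $\tau\neq j/2$ for all $j\in\mathbb{N}$, they are also asymptotically stable for all $c$ sufficiently large.
   Context: $\operatorname{sign}(0)=0$. A 1:1-periodic orbit is a solution (locally absolutely continuous, satisfying the equation almost everywhere) on $\mathbb{R}$ of prime period $1$ with finitely many zeros per period and exactly one nondegenerate upward crossing of zero per period, located at the phase $\alpha$ (modulo $1$); a zero is nondegenerate if it is isolated and $h$ changes sign there. The orbit is symmetric if $h(t)=-h(t+\tfrac12)$ for all $t$. "For all $c$ sufficiently large" means: for the given $\tau$ there is $C>0$ such that the assertion holds for all $c>C$. Stability is defined through Floquet multipliers of the linearized map. Write $\tau=k+\theta$, $k\in\{0,1,2,\dots\}$, $\theta\in(0,1)\setminus\{\tfrac12\}$. Perturbations $\mathcal{E}(t)$ sampled at the zeros of $h$ satisfy to leading order, for $m\in\mathbb{Z}$: if $\theta\in(0,\tfrac12)$, $$\mathcal{E}(m+1+\alpha)=\mathcal{E}(m+\alpha)-\tfrac{2}{h'(\alpha)}\bigl[\mathcal{E}(m-k+\alpha)+\mathcal{E}(m-k+\alpha+\tfrac12)\bigr],$$ $$\mathcal{E}(m+\tfrac32+\alpha)=\mathcal{E}(m+\tfrac12+\alpha)-\tfrac{2}{h'(\alpha)}\bigl[\mathcal{E}(m-k+\alpha+\tfrac12)+\mathcal{E}(m-k+\alpha+1)\bigr];$$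 if $\theta\in(\tfrac12,1)$, $$\mathcal{E}(m+1+\alpha)=\mathcal{E}(m+\alpha)-\tfrac{2}{h'(\alpha)}\bigl[\mathcal{E}(m-k-\tfrac12+\alpha)+\mathcal{E}(m-k+\alpha)\bigr],$$ $$\mathcal{E}(m+\tfrac32+\alpha)=\mathcal{E}(m+\tfrac12+\alpha)-\tfrac{2}{h'(\alpha)}\bigl[\mathcal{E}(m-k+\alpha)+\mathcal{E}(m-k+\alpha+\tfrac12)\bigr].$$ Substituting $(\mathcal{E}(m+\alpha),\mathcal{E}(m+\alpha+\tfrac12))=\lambda^m(v_1,v_2)$, moving all terms to the left and dividing each equation by the smallest power of $\lambda$ occurring in it gives a system $A(\lambda)(v_1,v_2)^T=0$ with polynomial entries; $\Delta(\lambda)=\det A(\lambda)$ is the characteristic polynomial and its roots (with multiplicity) are the Floquet multipliers. $\lambda=1$ is always a root (the trivial multiplier); the roots of $\Delta(\lambda)/(\lambda-1)$ are the nontrivial multipliers. The orbit is (asymptotically) stable if all nontrivial Floquet multipliers satisfy $|\lambda|<1$. *)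

theory Defs
  imports "HOL-Analysis.Analysis" "HOL-Computational_Algebra.Polynomial"
begin

section \<open>Solutions and 1:1-periodic orbits\<close>

text \<open>
  Absolute continuity of a function on a set; a division is a finite family of
  compact intervals with pairwise disjoint interiors, and the endpoints of its member
  \<open>K\<close> are \<open>Inf K\<close> and \<open>Sup K\<close>.
\<close>

definition absolutely_continuous_fun_on :: "real set \<Rightarrow> (real \<Rightarrow> real) \<Rightarrow> bool" where
  "absolutely_continuous_fun_on S f \<longleftrightarrow>
     (\<forall>\<epsilon>>0. \<exists>\<delta>>0. \<forall>\<D>. \<D> division_of \<Union>\<D> \<longrightarrow> \<Union>\<D> \<subseteq> S \<longrightarrow>
        (\<Sum>K\<in>\<D>. Sup K - Inf K) < \<delta> \<longrightarrow> (\<Sum>K\<in>\<D>. \<bar>f (Sup K) - f (Inf K)\<bar>) < \<epsilon>)"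

definition locally_absolutely_continuous :: "(real \<Rightarrow> real) \<Rightarrow> bool" where
  "locally_absolutely_continuous f \<longleftrightarrow> (\<forall>a b. absolutely_continuous_fun_on {a..b} f)"

definition dde_solution :: "real \<Rightarrow> real \<Rightarrow> (real \<Rightarrow> real) \<Rightarrow> bool" where
  "dde_solution \<tau> c h \<longleftrightarrow>
     locally_absolutely_continuous h \<and>
     (AE t in lebesgue. (h has_real_derivative (- sgn (h (t - \<tau>)) + c * cos (2 * pi * t))) (at t))"

definition has_prime_period :: "real \<Rightarrow> (real \<Rightarrow> real) \<Rightarrow> bool" where
  "has_prime_period p f \<longleftrightarrow>
     0 < p \<and> (\<forall>t. f (t + p) = f t) \<and> (\<forall>q. 0 < q \<and> q < p \<longrightarrow> \<not> (\<forall>t. f (t + q) = f t))"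

text \<open>The two sign conditions make the zero isolated, so it is nondegenerate.\<close>

definition upward_crossing :: "(real \<Rightarrow> real) \<Rightarrow> real \<Rightarrow> bool" where
  "upward_crossing h t \<longleftrightarrow>
     h t = 0 \<and> (\<forall>\<^sub>F s in at_left t. h s < 0) \<and> (\<forall>\<^sub>F s in at_right t. h s > 0)"

definition one_one_periodic_orbit :: "real \<Rightarrow> real \<Rightarrow> (real \<Rightarrow> real) \<Rightarrow> real \<Rightarrow> bool" where
  "one_one_periodic_orbit \<tau> c h \<alpha> \<longleftrightarrow>
     dde_solution \<tau> c h \<and> has_prime_period 1 h \<and>
     finite {t \<in> {0..<1}. h t = 0} \<and>
     {t. upward_crossing h t} = range (\<lambda>n::int. \<alpha> + of_int n)"

definition symmetric_orbit :: "(real \<Rightarrow> real) \<Rightarrow> bool" where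
  "symmetric_orbit h \<longleftrightarrow> (\<forall>t. h t = - h (t + 1/2))"


section \<open>Linearized map and Floquet multipliers\<close>

text \<open>
  The linearized recursions for perturbations \<open>E\<close>, with \<open>k = \<lfloor>\<tau>\<rfloor>\<close>, \<open>\<theta> = frac \<tau>\<close> and \<open>d\<close>
  standing for \<open>h'(\<alpha>)\<close>. They are meant for \<open>\<theta>\<close> different from \<open>0\<close> and \<open>1/2\<close>.
\<close>

definition linearized_system :: "real \<Rightarrow> real \<Rightarrow> real \<Rightarrow> (real \<Rightarrow> complex) \<Rightarrow> bool" where
  "linearized_system \<tau> \<alpha> d E \<longleftrightarrow>
     (let k = of_int \<lfloor>\<tau>\<rfloor> in
      if frac \<tau> < 1/2 then
        (\<forall>n::int. let m = of_int n in
           E (m + 1 + \<alpha>) = E (m + \<alpha>)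
             - of_real (2 / d) * (E (m - k + \<alpha>) + E (m - k + \<alpha> + 1/2)) \<and>
           E (m + 3/2 + \<alpha>) = E (m + 1/2 + \<alpha>)
             - of_real (2 / d) * (E (m - k + \<alpha> + 1/2) + E (m - k + \<alpha> + 1)))
      else
        (\<forall>n::int. let m = of_int n in
           E (m + 1 + \<alpha>) = E (m + \<alpha>)
             - of_real (2 / d) * (E (m - k - 1/2 + \<alpha>) + E (m - k + \<alpha>)) \<and>
           E (m + 3/2 + \<alpha>) = E (m + 1/2 + \<alpha>)
             - of_real (2 / d) * (E (m - k + \<alpha>) + E (m - k + \<alpha> + 1/2))))"

text \<open>
  The same equations with all terms on the left: an entry \<open>(b, s)\<close> is the term
  \<open>b E(m + s/2 + \<alpha>)\<close>.
\<close>

definition linearized_terms :: "real \<Rightarrow> real \<Rightarrow> 2 \<Rightarrow> (real \<times> int) list" where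
  "linearized_terms \<tau> d i =
     (let k = \<lfloor>\<tau>\<rfloor>; a = 2 / d in
      if frac \<tau> < 1/2 then
        (if i = 1 then [(1, 2), (- 1, 0), (a, - 2 * k), (a, - 2 * k + 1)]
                  else [(1, 3), (- 1, 1), (a, - 2 * k + 1), (a, - 2 * k + 2)])
      else
        (if i = 1 then [(1, 2), (- 1, 0), (a, - 2 * k - 1), (a, - 2 * k)]
                  else [(1, 3), (- 1, 1), (a, - 2 * k), (a, - 2 * k + 1)]))"

text \<open>
  Under \<open>(E(m + \<alpha>), E(m + 1/2 + \<alpha>)) = \<lambda>^m (v1, v2)\<close> the term \<open>b E(m + s/2 + \<alpha>)\<close> becomes
  \<open>b \<lambda>^(m + s div 2)\<close> times \<open>v1\<close> if \<open>s\<close> is even and times \<open>v2\<close> if \<open>s\<close> is odd. Dividing equation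
  \<open>i\<close> by its smallest power of \<open>\<lambda>\<close> leaves row \<open>i\<close> of the following matrix.
\<close>

definition floquet_matrix :: "real \<Rightarrow> real \<Rightarrow> complex poly ^ 2 ^ 2" where
  "floquet_matrix \<tau> d = (\<chi> i j.
     let ts = linearized_terms \<tau> d i; p = Min ((\<lambda>(b, s). s div 2) ` set ts) in
     (\<Sum>(b, s)\<leftarrow>ts. if even s = (j = 1) then monom (of_real b) (nat (s div 2 - p)) else 0))"

definition characteristic_poly :: "real \<Rightarrow> real \<Rightarrow> complex poly" where
  "characteristic_poly \<tau> d = det (floquet_matrix \<tau> d)"

text \<open>
  The quotient by \<open>\<lambda> - 1\<close> is exact (\<open>trivial_multiplier\<close> below), so \<open>1\<close> counts as a nontrivial
  multiplier precisely when it is a multiple root of the characteristic polynomial.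
\<close>

definition nontrivial_multipliers :: "real \<Rightarrow> real \<Rightarrow> complex set" where
  "nontrivial_multipliers \<tau> d = {z. poly (characteristic_poly \<tau> d div [:- 1, 1:]) z = 0}"

definition asymptotically_stable_orbit :: "real \<Rightarrow> (real \<Rightarrow> real) \<Rightarrow> real \<Rightarrow> bool" where
  "asymptotically_stable_orbit \<tau> h \<alpha> \<longleftrightarrow> (\<forall>z\<in>nontrivial_multipliers \<tau> (deriv h \<alpha>). norm z < 1)"


section \<open>Consistency of the encoding\<close>

lemma floquet_matrix_small:
  fixes \<tau> d :: real
  assumes "\<tau> > 0" "frac \<tau> < 1/2"
  defines "k \<equiv> nat \<lfloor>\<tau>\<rfloor>" and "a \<equiv> of_real (2 / d) :: complex"
  shows "floquet_matrix \<tau> d $ 1 $ 1 = monom 1 (k + 1) - monom 1 k + [:a:]"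
    and "floquet_matrix \<tau> d $ 1 $ 2 = [:a:]"
    and "floquet_matrix \<tau> d $ 2 $ 1 = monom a 1"
    and "floquet_matrix \<tau> d $ 2 $ 2 = monom 1 (k + 1) - monom 1 k + [:a:]"
proof -
  have f: "\<lfloor>\<tau>\<rfloor> = int k" using assms by simp
  have d: "(2 - 2 * int k) div 2 = 1 - int k" "(1 - 2 * int k) div 2 = - int k"
     "(- (2 * int k)) div 2 = - int k" "(3::int) div 2 = 1"
    by presburger+
  show "floquet_matrix \<tau> d $ 1 $ 1 = monom 1 (k + 1) - monom 1 k + [:a:]"
    "floquet_matrix \<tau> d $ 1 $ 2 = [:a:]"
    "floquet_matrix \<tau> d $ 2 $ 1 = monom a 1"
    "floquet_matrix \<tau> d $ 2 $ 2 = monom 1 (k + 1) - monom 1 k + [:a:]"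
    using assms(2) by (simp_all add: floquet_matrix_def linearized_terms_def Let_def f d
        min_def a_def nat_add_distrib monom_0 minus_monom [symmetric])
qed

lemma floquet_matrix_large:
  fixes \<tau> d :: real
  assumes "\<tau> > 0" "frac \<tau> > 1/2"
  defines "k \<equiv> nat \<lfloor>\<tau>\<rfloor>" and "a \<equiv> of_real (2 / d) :: complex"
  shows "floquet_matrix \<tau> d $ 1 $ 1 = monom 1 (k + 2) - monom 1 (k + 1) + monom a 1"
    and "floquet_matrix \<tau> d $ 1 $ 2 = [:a:]"
    and "floquet_matrix \<tau> d $ 2 $ 1 = [:a:]"
    and "floquet_matrix \<tau> d $ 2 $ 2 = monom 1 (k + 1) - monom 1 k + [:a:]"
proof -
  have f: "\<lfloor>\<tau>\<rfloor> = int k" using assms by simp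
  have d: "(1 - 2 * int k) div 2 = - int k" "(- (2 * int k) - 1) div 2 = - int k - 1"
     "(- (2 * int k)) div 2 = - int k" "(3::int) div 2 = 1"
    by presburger+
  show "floquet_matrix \<tau> d $ 1 $ 1 = monom 1 (k + 2) - monom 1 (k + 1) + monom a 1"
    "floquet_matrix \<tau> d $ 1 $ 2 = [:a:]"
    "floquet_matrix \<tau> d $ 2 $ 1 = [:a:]"
    "floquet_matrix \<tau> d $ 2 $ 2 = monom 1 (k + 1) - monom 1 k + [:a:]"
    using assms(2) by (simp_all add: floquet_matrix_def linearized_terms_def Let_def f d
        min_def a_def nat_add_distrib monom_0 minus_monom [symmetric])
qed

lemma trivial_multiplier:
  assumes "\<tau> > 0" "frac \<tau> \<noteq> 1/2"
  shows "[:- 1, 1:] dvd characteristic_poly \<tau> d"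
proof -
  have "poly (characteristic_poly \<tau> d) 1 = 0"
    using assms floquet_matrix_small[of \<tau> d] floquet_matrix_large[of \<tau> d]
    by (cases "frac \<tau> < 1/2") (auto simp: characteristic_poly_def det_2 poly_monom)
  thus ?thesis by (simp add: poly_eq_0_iff_dvd)
qed

lemma linearized_system_iff_floquet_matrix:
  fixes E :: "real \<Rightarrow> complex" and z v1 v2 :: complex
  assumes "\<tau> > 0" "frac \<tau> \<noteq> 1/2" "z \<noteq> 0"
    and E: "\<And>m::int. E (of_int m + \<alpha>) = z powi m * v1"
           "\<And>m::int. E (of_int m + \<alpha> + 1/2) = z powi m * v2"
  shows "linearized_system \<tau> \<alpha> d E \<longleftrightarrow>
    (\<forall>i. poly (floquet_matrix \<tau> d $ i $ 1) z * v1 + poly (floquet_matrix \<tau> d $ i $ 2) z * v2 = 0)"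
  (is "_ \<longleftrightarrow> ?rhs")
proof -
  define k a where "k = nat \<lfloor>\<tau>\<rfloor>" and "a = complex_of_real (2 / d)"
  have f: "\<lfloor>\<tau>\<rfloor> = int k" using assms by (simp add: k_def)
  note P = power_int_add[of z] power_int_diff[of z]
  have e1: "E (real_of_int n + 1 + \<alpha>) = z powi n * z * v1" for n
    using E(1)[of "n + 1"] assms(3) by (simp add: P algebra_simps)
  have e2: "E (real_of_int n - real k + \<alpha>) = z powi n / z ^ k * v1" for n
    using E(1)[of "n - int k"] assms(3) by (simp add: P algebra_simps)
  have e3: "E (real_of_int n - real k + \<alpha> + 1/2) = z powi n / z ^ k * v2" for n
    using E(2)[of "n - int k"] assms(3) by (simp add: P algebra_simps)
  have e4: "E (real_of_int n - real k + \<alpha> + 1) = z powi n / z ^ k * z * v1" for n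
    using E(1)[of "n - int k + 1"] assms(3) by (simp add: P algebra_simps)
  have e5: "E (real_of_int n + 3/2 + \<alpha>) = z powi n * z * v2" for n
    using E(2)[of "n + 1"] assms(3) by (simp add: P algebra_simps)
  have e6: "E (real_of_int n + 1/2 + \<alpha>) = z powi n * v2" for n
    using E(2)[of n] by (simp add: algebra_simps)
  have e7: "E (real_of_int n - real k - 1/2 + \<alpha>) = z powi n / z ^ k / z * v2" for n
    using E(2)[of "n - int k - 1"] assms(3) by (simp add: P algebra_simps)
  note e = e1 e2 e3 e4 e5 e6 e7 E(1)
  have nz: "z powi n \<noteq> 0" "z ^ k \<noteq> 0" for n using assms(3) by auto
  show ?thesis
  proof (cases "frac \<tau> < 1/2")
    case True
    have 1: "z powi n * z * v1 = z powi n * v1 - a * (z powi n / z ^ k * v1 + z powi n / z ^ k * v2)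
        \<longleftrightarrow> (z ^ (k+1) - z ^ k + a) * v1 + a * v2 = 0" for n
    proof -
      have "z powi n * z * v1 - (z powi n * v1 - a * (z powi n / z ^ k * v1 + z powi n / z ^ k * v2))
        = z powi n / z ^ k * ((z ^ (k+1) - z ^ k + a) * v1 + a * v2)"
        using nz assms(3) by (simp add: field_simps)
      thus ?thesis using nz by (metis (no_types, lifting) divide_eq_0_iff mult_eq_0_iff eq_iff_diff_eq_0)
    qed
    have 2: "z powi n * z * v2 = z powi n * v2 - a * (z powi n / z ^ k * v2 + z powi n / z ^ k * z * v1)
        \<longleftrightarrow> a * z * v1 + (z ^ (k+1) - z ^ k + a) * v2 = 0" for n
    proof -
      have "z powi n * z * v2 - (z powi n * v2 - a * (z powi n / z ^ k * v2 + z powi n / z ^ k * z * v1))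
        = z powi n / z ^ k * (a * z * v1 + (z ^ (k+1) - z ^ k + a) * v2)"
        using nz assms(3) by (simp add: field_simps)
      thus ?thesis using nz by (metis (no_types, lifting) divide_eq_0_iff mult_eq_0_iff eq_iff_diff_eq_0)
    qed
    have "linearized_system \<tau> \<alpha> d E \<longleftrightarrow> (\<forall>n. z powi n * z * v1 = z powi n * v1 - a * (z powi n / z ^ k * v1 + z powi n / z ^ k * v2) \<and> z powi n * z * v2 = z powi n * v2 - a * (z powi n / z ^ k * v2 + z powi n / z ^ k * z * v1))"
      using True by (simp add: linearized_system_def Let_def f e flip: a_def del: of_real_divide)
    also have "\<dots> \<longleftrightarrow> (z ^ (k+1) - z ^ k + a) * v1 + a * v2 = 0 \<and> a * z * v1 + (z ^ (k+1) - z ^ k + a) * v2 = 0"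
      by (simp only: 1 2 simp_thms)
    also have "\<dots> \<longleftrightarrow> ?rhs"
      by (simp add: forall_2 poly_monom algebra_simps
          floquet_matrix_small[OF assms(1) True, of d, folded k_def a_def])
    finally show ?thesis .
  next
    case False
    hence L: "frac \<tau> > 1/2" using assms(2) by simp
    have 1: "z powi n * z * v1 = z powi n * v1 - a * (z powi n / z ^ k / z * v2 + z powi n / z ^ k * v1)
        \<longleftrightarrow> (z ^ (k+2) - z ^ (k+1) + a * z) * v1 + a * v2 = 0" for n
    proof -
      have "z powi n * z * v1 - (z powi n * v1 - a * (z powi n / z ^ k / z * v2 + z powi n / z ^ k * v1))
        = z powi n / z ^ k / z * ((z ^ (k+2) - z ^ (k+1) + a * z) * v1 + a * v2)"
        using nz assms(3) by (simp add: field_simps)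
      thus ?thesis using nz assms(3) by (metis (no_types, lifting) divide_eq_0_iff mult_eq_0_iff eq_iff_diff_eq_0)
    qed
    have 2: "z powi n * z * v2 = z powi n * v2 - a * (z powi n / z ^ k * v1 + z powi n / z ^ k * v2)
        \<longleftrightarrow> a * v1 + (z ^ (k+1) - z ^ k + a) * v2 = 0" for n
    proof -
      have "z powi n * z * v2 - (z powi n * v2 - a * (z powi n / z ^ k * v1 + z powi n / z ^ k * v2))
        = z powi n / z ^ k * (a * v1 + (z ^ (k+1) - z ^ k + a) * v2)"
        using nz assms(3) by (simp add: field_simps)
      thus ?thesis using nz by (metis (no_types, lifting) divide_eq_0_iff mult_eq_0_iff eq_iff_diff_eq_0)
    qed
    have "linearized_system \<tau> \<alpha> d E \<longleftrightarrow> (\<forall>n. z powi n * z * v1 = z powi n * v1 - a * (z powi n / z ^ k / z * v2 + z powi n / z ^ k * v1) \<and> z powi n * z * v2 = z powi n * v2 - a * (z powi n / z ^ k * v1 + z powi n / z ^ k * v2))"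
      using False by (simp add: linearized_system_def Let_def f e flip: a_def del: of_real_divide)
    also have "\<dots> \<longleftrightarrow> (z ^ (k+2) - z ^ (k+1) + a * z) * v1 + a * v2 = 0 \<and> a * v1 + (z ^ (k+1) - z ^ k + a) * v2 = 0"
      by (simp only: 1 2 simp_thms)
    also have "\<dots> \<longleftrightarrow> ?rhs"
      by (simp add: forall_2 poly_monom algebra_simps
          floquet_matrix_large[OF assms(1) L, of d, folded k_def a_def])
    finally show ?thesis .
  qed
qed

end

theory Submission
  imports Defs
begin

text \<open>
  Write \<open>h(t) = c/(2 \<pi>) sin(2 \<pi> t) + g(t)\<close>. Since \<open>g' = - sgn (h (t - \<tau>))\<close> almost everywhere and \<open>h\<close> is
  absolutely continuous, \<open>g\<close> is 1-Lipschitz; the symmetry \<open>g(t + 1/2) = - g(t)\<close> then gives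
  \<open>|g| \<le> 1/4\<close>. Hence, once \<open>c \<ge> 4\<close>, \<open>h\<close> has the sign of \<open>sin(2 \<pi> (t - \<alpha>))\<close>. This determines \<open>g\<close>
  as a shifted triangle wave, and \<open>h(\<alpha>) = 0\<close> becomes an equation for \<open>sin(2 \<pi> \<alpha>)\<close>, solvable for
  large \<open>c\<close>. If \<open>\<tau>\<close> is not a half-integer, the delayed sign is constant near \<open>\<alpha>\<close>, so \<open>h'(\<alpha>)\<close>
  exists and grows linearly in \<open>c\<close>.

  With \<open>a = 2/h'(\<alpha>)\<close> the characteristic polynomial is, up to the factor \<open>\<lambda> - 1\<close>, either
  \<open>\<lambda>^(2k+1) - (\<lambda>^k - a)^2\<close> or \<open>(\<lambda>^(k+1) + a)^2 - \<lambda>^(2k+1)\<close>. Putting \<open>\<lambda> = \<mu>^2\<close>, it splits, and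
  a nontrivial multiplier satisfies \<open>\<mu>^n (1 - \<mu>) = a\<close> for a square root \<open>\<mu>\<close> and \<open>n = 2k\<close> or
  \<open>n = 2k + 1\<close>. For small \<open>a\<close> this is impossible with \<open>|\<mu>| \<ge> 1\<close>, because \<open>\<mu>\<close> would be within \<open>a\<close> of 1
  and \<open>1 - \<mu> = a \<mu>^(-n)\<close> would have real part close to \<open>a\<close>.
\<close>

section \<open>Derivative bounds almost everywhere for absolutely continuous functions\<close>

text \<open>
  Cousin's lemma: tags at which the derivative bound fails lie in a null set, so their intervals
  can be kept inside an open set of small measure, where absolute continuity controls \<open>f\<close>.
\<close>

lemma absolutely_continuous_lipschitz_bound:
  fixes f :: "real \<Rightarrow> real"
  assumes ac: "absolutely_continuous_fun_on {a..b} f" and ab: "a \<le> b" and L: "0 \<le> L"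
    and ae: "AE t in lebesgue. t \<in> {a..b} \<longrightarrow> (\<exists>D. \<bar>D\<bar> \<le> L \<and> (f has_real_derivative D) (at t))"
  shows "\<bar>f b - f a\<bar> \<le> L * (b - a)"
proof -
  \<comment> \<open>The slack \<open>e\<close> is spent twice: as extra slope at tags where
    \<open>f\<close> is differentiable, and as the total contribution of the tags in the null
    set.\<close>
  have key: "\<bar>f b - f a\<bar> \<le> (L + e) * (b - a) + e" if e: "e > 0" for e :: real
  proof -
    obtain \<delta> where \<delta>: "\<delta> > 0" and ac': "\<And>\<D>. \<D> division_of \<Union>\<D> \<Longrightarrow> \<Union>\<D> \<subseteq> {a..b} \<Longrightarrow>
        (\<Sum>K\<in>\<D>. Sup K - Inf K) < \<delta> \<Longrightarrow> (\<Sum>K\<in>\<D>. \<bar>f (Sup K) - f (Inf K)\<bar>) < e"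
      using ac e unfolding absolutely_continuous_fun_on_def by meson
    obtain N where N: "\<And>t. t \<in> space lebesgue - N \<Longrightarrow> t \<in> {a..b} \<longrightarrow> (\<exists>D. \<bar>D\<bar> \<le> L \<and> (f has_real_derivative D) (at t))"
      "N \<in> null_sets lebesgue"
      by (rule AE_E3[OF ae]) blast
    obtain U where U: "open U" "N \<subseteq> U" "emeasure lebesgue (U - N) < ennreal \<delta>"
      using sets_lebesgue_outer_open[OF null_setsD2[OF N(2)] \<delta>] by metis
    have eU: "emeasure lebesgue U < ennreal \<delta>"
      using U(1,3) N(2) emeasure_Diff_null_set[of N lebesgue U] by auto
    have Um: "U \<in> lmeasurable"
      using eU U(1) by (auto simp: fmeasurable_def intro: less_trans)
    have mU: "measure lebesgue U < \<delta>"
      using eU \<delta> Um by (simp add: emeasure_eq_measure2 ennreal_less_iff)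
    have "\<exists>d>0. \<forall>y. \<bar>y - t\<bar> < d \<longrightarrow> \<bar>f y - f t\<bar> \<le> (L + e) * \<bar>y - t\<bar>"
      if t: "t \<in> {a..b} - N" for t
    proof -
      obtain D where D: "\<bar>D\<bar> \<le> L" "(f has_real_derivative D) (at t)"
        using N(1)[of t] t by auto
      have "\<exists>d>0. \<forall>y. \<bar>y - t\<bar> < d \<longrightarrow> \<bar>f y - f t - D * (y - t)\<bar> \<le> e * \<bar>y - t\<bar>"
        using D(2) e unfolding has_field_derivative_def has_derivative_at_alt real_norm_def
        by blast
      then obtain d where d: "d > 0"
        "\<And>y. \<bar>y - t\<bar> < d \<Longrightarrow> \<bar>f y - f t - D * (y - t)\<bar> \<le> e * \<bar>y - t\<bar>"
        by blast
      have "\<bar>f y - f t\<bar> \<le> (L + e) * \<bar>y - t\<bar>" if "\<bar>y - t\<bar> < d" for y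
      proof -
        have "\<bar>D * (y - t)\<bar> \<le> L * \<bar>y - t\<bar>"
          using D(1) by (simp add: abs_mult mult_right_mono)
        with d(2)[OF that] show ?thesis by (simp add: algebra_simps)
      qed
      with d(1) show ?thesis by blast
    qed
    then obtain r where r: "\<And>t. t \<in> {a..b} - N \<Longrightarrow> r t > 0"
      "\<And>t y. t \<in> {a..b} - N \<Longrightarrow> \<bar>y - t\<bar> < r t \<Longrightarrow> \<bar>f y - f t\<bar> \<le> (L + e) * \<bar>y - t\<bar>"
      by metis
    define \<gamma> where "\<gamma> t = (if t \<in> N then U else if t \<in> {a..b} then ball t (r t) else ball t 1)" for t
    have "gauge \<gamma>"
      using U r(1) by (auto simp: gauge_def \<gamma>_def)
    then obtain p where p: "p tagged_division_of {a..b}" "\<gamma> fine p"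
      using fine_division_exists_real by blast
    note pD = tagged_division_ofD[OF p(1)]
    have pK: "\<exists>u v. K = {u..v} \<and> u \<le> x \<and> x \<le> v \<and> K \<subseteq> {a..b} \<and> K \<subseteq> \<gamma> x"
      if "(x, K) \<in> p" for x K
      using pD(2,3,4)[OF that] p(2) that by (auto simp: fine_def)
    define p1 where "p1 = {xK \<in> p. fst xK \<in> N}"
    have p1p: "p1 \<subseteq> p" by (auto simp: p1_def)
    have part: "p1 tagged_partial_division_of {a..b}"
      using p(1) by (intro tagged_partial_division_subset[OF _ p1p]) (simp add: tagged_division_of_def)
    have tag: "p1 tagged_division_of \<Union>(snd ` p1)"
      by (rule tagged_partial_division_of_Union_self[OF part])
    have div: "snd ` p1 division_of \<Union>(snd ` p1)"
      by (rule partial_division_of_tagged_division[OF part])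
    have sub: "\<Union>(snd ` p1) \<subseteq> {a..b}" "\<Union>(snd ` p1) \<subseteq> U"
      using pK p1p by (fastforce simp: p1_def \<gamma>_def)+
    have cont: "Sup K - Inf K = measure lebesgue K" "K \<noteq> {}" if K: "K \<in> snd ` p1" for K
      using K pK p1p by (fastforce simp: content_real)+
    have "(\<Sum>K\<in>snd ` p1. Sup K - Inf K) = (\<Sum>K\<in>snd ` p1. measure lebesgue K)"
      using cont by (intro sum.cong) auto
    also have "\<dots> = measure lebesgue (\<Union>(snd ` p1))"
      using content_division[OF div] by simp
    also have "\<dots> \<le> measure lebesgue U"
      using sub(2) Um lmeasurable_division[OF div] by (intro measure_mono_fmeasurable fmeasurableD)
    finally have small: "(\<Sum>K\<in>snd ` p1. Sup K - Inf K) < \<delta>" using mU by simp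
    \<comment> \<open>Regrouping a sum over tagged pairs into a sum over intervals needs a summand
      that vanishes on every interval with empty interior. Degenerate intervals satisfy this
      already; the empty set has no endpoints, so the value 0 is prescribed there.\<close>
    define d where "d K = (if K = {} then 0 else \<bar>f (Sup K) - f (Inf K)\<bar>)" for K
    have "(\<Sum>(x,K)\<in>p1. \<bar>f (Sup K) - f (Inf K)\<bar>) = (\<Sum>(x,K)\<in>p1. d K)"
      using cont(2) by (intro sum.cong) (force simp: d_def)+
    also have "\<dots> = (\<Sum>K\<in>snd ` p1. d K)"
      by (rule sum.over_tagged_division_lemma[OF tag]) (auto simp: d_def)
    also have "\<dots> = (\<Sum>K\<in>snd ` p1. \<bar>f (Sup K) - f (Inf K)\<bar>)"
      using cont(2) by (intro sum.cong) (force simp: d_def)+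
    also have "\<dots> < e" by (rule ac'[OF div sub(1) small])
    finally have s1: "(\<Sum>(x,K)\<in>p1. \<bar>f (Sup K) - f (Inf K)\<bar>) < e" .
    have fp: "finite p" using pD(1) by simp
    have "(\<Sum>(x,K)\<in>p - p1. \<bar>f (Sup K) - f (Inf K)\<bar>) \<le> (\<Sum>(x,K)\<in>p - p1. (L + e) * measure lborel K)"
    proof (rule sum_mono, clarify)
      fix x K assume xK: "(x, K) \<in> p" "(x, K) \<notin> p1"
      obtain u v where uv: "K = {u..v}" "u \<le> x" "x \<le> v" "K \<subseteq> {a..b}" "K \<subseteq> \<gamma> x"
        using pK[OF xK(1)] by blast
      have x: "x \<in> {a..b} - N" using xK uv by (auto simp: p1_def)
      have "K \<subseteq> ball x (r x)" "u \<in> K" "v \<in> K"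
        using uv x by (auto simp: \<gamma>_def)
      then have "u \<in> ball x (r x)" "v \<in> ball x (r x)" by blast+
      \<comment> \<open>The tag lies between the endpoints, so the bounds on its two sides add up to
        one over the whole interval.\<close>
      then have "\<bar>f u - f x\<bar> \<le> (L + e) * \<bar>u - x\<bar>" "\<bar>f v - f x\<bar> \<le> (L + e) * \<bar>v - x\<bar>"
        using x by (auto intro!: r(2) simp: dist_real_def)
      then have "\<bar>f v - f u\<bar> \<le> (L + e) * (v - u)"
        using uv by (simp add: algebra_simps)
      then show "\<bar>f (Sup K) - f (Inf K)\<bar> \<le> (L + e) * measure lborel K"
        using uv by (simp add: content_real)
    qed
    also have "\<dots> \<le> (\<Sum>(x,K)\<in>p. (L + e) * measure lborel K)"
      using L e fp by (intro sum_mono2) auto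
    also have "\<dots> = (L + e) * (\<Sum>(x,K)\<in>p. measure lborel K)"
      by (simp add: sum_distrib_left case_prod_unfold)
    also have "\<dots> = (L + e) * (b - a)"
      using additive_content_tagged_division[of p a b] p(1) ab by simp
    finally have s2: "(\<Sum>(x,K)\<in>p - p1. \<bar>f (Sup K) - f (Inf K)\<bar>) \<le> (L + e) * (b - a)" .
    have "\<bar>f b - f a\<bar> = \<bar>\<Sum>(x,K)\<in>p. f (Sup K) - f (Inf K)\<bar>"
      using additive_tagged_division_1[OF ab p(1), of f] by simp
    also have "\<dots> \<le> (\<Sum>(x,K)\<in>p. \<bar>f (Sup K) - f (Inf K)\<bar>)"
      by (rule order_trans[OF sum_abs]) (simp add: case_prod_unfold)
    also have "\<dots> = (\<Sum>(x,K)\<in>p - p1. \<bar>f (Sup K) - f (Inf K)\<bar>) + (\<Sum>(x,K)\<in>p1. \<bar>f (Sup K) - f (Inf K)\<bar>)"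
      by (rule sum.subset_diff[OF p1p fp])
    finally show ?thesis using s1 s2 by linarith
  qed
  have "((\<lambda>e. (L + e) * (b - a) + e) \<longlongrightarrow> (L + 0) * (b - a) + 0) (at_right 0)"
    by (intro tendsto_intros)
  then show ?thesis
    using tendsto_lowerbound[of "\<lambda>e. (L + e) * (b - a) + e" "L * (b - a)" "at_right 0" "\<bar>f b - f a\<bar>"] key
    by (simp add: eventually_at_right_less eventually_mono[OF eventually_at_right_less])
qed

section \<open>Location of the Floquet multipliers\<close>

text \<open>A solution would satisfy \<open>1 - \<mu> = a * \<zeta>\<close> with
  \<open>\<zeta>\<close> the inverse of \<open>\<mu> ^ n\<close>. Then \<open>\<mu>\<close> is
  within \<open>a\<close> of 1 and \<open>\<zeta>\<close> within \<open>n * a\<close> of 1, so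
  expanding the squared norm of \<open>1 - (1 - \<mu>)\<close> gives at most
  \<open>1 - 2 * a * (1 - n * a) + a * a\<close>, which is below 1.\<close>

lemma power_times_one_minus_neq:
  fixes \<mu> :: complex and a :: real
  assumes a: "0 < a" "a * (real n + 1) < 1" and \<mu>: "1 \<le> norm \<mu>"
  shows "\<mu> ^ n * (1 - \<mu>) \<noteq> of_real a"
proof
  assume eq: "\<mu> ^ n * (1 - \<mu>) = of_real a"
  define \<zeta> where "\<zeta> = inverse \<mu> ^ n"
  have nz: "\<mu> \<noteq> 0" using \<mu> by auto
  have inv1: "norm (inverse \<mu>) \<le> 1" using \<mu> by (simp add: norm_inverse inverse_le_1_iff)
  have w: "1 - \<mu> = of_real a * \<zeta>"
    using eq nz by (simp add: \<zeta>_def field_simps)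
  have nw: "norm (1 - \<mu>) \<le> a"
    using a inv1 by (simp add: w \<zeta>_def norm_mult norm_power mult_left_le power_le_one)
  have "norm (\<zeta> - 1) \<le> real n * norm (inverse \<mu> - 1)"
    using norm_power_diff[of "inverse \<mu>" 1 n] inv1 by (simp add: \<zeta>_def)
  also have "norm (inverse \<mu> - 1) = norm (inverse \<mu>) * norm (1 - \<mu>)"
    using nz by (simp add: field_simps flip: norm_mult)
  also have "\<dots> \<le> 1 * a"
    using inv1 nw by (intro mult_mono) auto
  finally have "norm (\<zeta> - 1) \<le> real n * a" by (simp add: mult_left_mono)
  then have re: "Re \<zeta> \<ge> 1 - real n * a"
    using abs_Re_le_cmod[of "\<zeta> - 1"] by simp
  have "(norm \<mu>)\<^sup>2 = (norm (1 - (1 - \<mu>)))\<^sup>2" by simp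
  also have "\<dots> = 1 - 2 * Re (1 - \<mu>) + (norm (1 - \<mu>))\<^sup>2"
    by (simp add: cmod_power2) (simp add: power2_eq_square algebra_simps)
  also have "\<dots> \<le> 1 - 2 * (a * Re \<zeta>) + a\<^sup>2"
    using nw a by (simp add: w power_mono)
  also have "\<dots> \<le> 1 - 2 * (a * (1 - real n * a)) + a\<^sup>2"
    using re a by (simp add: mult_left_mono)
  also have "\<dots> < 1"
  proof -
    have "a * (2 * (1 - real n * a) - a) > 0"
      using a by (intro mult_pos_pos) (auto simp: algebra_simps)
    then show ?thesis by (simp add: algebra_simps power2_eq_square)
  qed
  finally have "norm \<mu> < 1" using power2_less_imp_less[of "norm \<mu>" 1] by simp
  with \<mu> show False by simp
qed

text \<open>After removal of the trivial factor, a square root of the multiplier turns the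
  polynomial into a difference of two squares. Each linear factor is an instance of the equation
  excluded above, with exponent at most \<open>2 * k + 1\<close>; this is where the bound
  \<open>2 * k + 2\<close> comes from.\<close>

lemma nontrivial_multipliers_norm_less_one:
  assumes \<tau>: "\<tau> > 0" "frac \<tau> \<noteq> 1/2" and d: "d > 0" "2 / d * (2 * real (nat \<lfloor>\<tau>\<rfloor>) + 2) < 1"
    and z: "z \<in> nontrivial_multipliers \<tau> d"
  shows "norm z < 1"
proof (rule ccontr)
  define k a where "k = nat \<lfloor>\<tau>\<rfloor>" and "a = complex_of_real (2 / d)"
  define \<mu> where "\<mu> = csqrt z"
  have z\<mu>: "z = \<mu>\<^sup>2" by (simp add: \<mu>_def)
  assume "\<not> norm z < 1"
  then have "1 \<le> norm \<mu>" by (simp add: z\<mu> norm_power abs_square_less_1)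
  \<comment> \<open>The sign \<open>s\<close> covers both square roots of \<open>z\<close>.\<close>
  then have neq: "(s * \<mu>) ^ n * (1 - s * \<mu>) \<noteq> a" if "n \<le> 2 * k + 1" "s \<in> {1, -1}" for n s
  proof -
    have "2 / d * (real n + 1) \<le> 2 / d * (2 * real k + 2)"
      using that d by (intro mult_left_mono) auto
    then show ?thesis unfolding a_def
      using that \<open>1 \<le> norm \<mu>\<close> d by (intro power_times_one_minus_neq) (auto simp: k_def)
  qed
  have q: "poly q z = 0" if "characteristic_poly \<tau> d = [:-1, 1:] * q" for q
  proof -
    have "characteristic_poly \<tau> d div [:-1, 1:] = q"
      unfolding that by (rule nonzero_mult_div_cancel_left) simp
    then show ?thesis using z by (simp add: nontrivial_multipliers_def)
  qed
  have pw: "x ^ (2 * k + 1) = x ^ k * x ^ k * x" "x ^ (k + 1) = x ^ k * x" "x ^ (k + 2) = x ^ k * x * x"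
    for x :: complex
    by (simp_all add: power_add mult_2 power2_eq_square)
  define m where "m = \<mu> ^ k"
  have zk: "z ^ k = m\<^sup>2"
    by (simp add: z\<mu> m_def mult.commute flip: power_mult)
  \<comment> \<open>The redundant terms \<open>x * 0\<close>, \<open>x ^ 1\<close> and
    \<open>1 * y\<close> reproduce what \<open>poly_pCons\<close> and \<open>poly_monom\<close>
    leave behind, so that the identity matches the goal as it stands.\<close>
  have id1: "(1 * (y * x) - 1 * y + (a + x * 0)) * (1 * (y * x) - 1 * y + (a + x * 0)) - (a + x * 0) * (a * x ^ 1)
      = (- 1 + x * (1 + x * 0)) * (1 * (y * y * x) - (1 * y - (a + x * 0))\<^sup>2)" for x y :: complex
    by algebra
  have id2: "(1 * (y * x * x) - 1 * (y * x) + a * x ^ 1) * (1 * (y * x) - 1 * y + (a + x * 0)) - (a + x * 0) * (a + x * 0)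
      = (- 1 + x * (1 + x * 0)) * ((1 * (y * x) + (a + x * 0))\<^sup>2 - 1 * (y * y * x))" for x y :: complex
    by algebra
  show False
  proof (cases "frac \<tau> < 1/2")
    case True
    have "characteristic_poly \<tau> d = [:-1, 1:] * (monom 1 (2 * k + 1) - (monom 1 k - [:a:])\<^sup>2)"
      unfolding characteristic_poly_def det_2 floquet_matrix_small[OF \<tau>(1) True, of d, folded k_def a_def]
      by (intro poly_ext, simp only: poly_add poly_diff poly_mult poly_power poly_monom poly_pCons poly_0 pw)
        (rule id1)
    from q[OF this] have "z ^ k * z ^ k * z - (z ^ k - a)\<^sup>2 = 0"
      by (simp only: poly_add poly_diff poly_power poly_monom poly_pCons poly_0 pw mult_1_left mult_zero_right add_0_right)
    \<comment> \<open>With \<open>z = \<mu>\<^sup>2\<close> the term \<open>z ^ (2 * k + 1)\<close>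
      is the square of \<open>m\<^sup>2 * \<mu>\<close>. The factors belong to the roots
      \<open>\<mu>\<close> and \<open>-\<mu>\<close> with the even exponent
      \<open>2 * k\<close>.\<close>
    then have "(m\<^sup>2 * (1 - \<mu>) - a) * (m\<^sup>2 * (1 + \<mu>) - a) = 0"
      unfolding zk unfolding z\<mu> by algebra
    then show False using neq[of "2 * k" 1] neq[of "2 * k" "-1"] by (simp add: m_def flip: power_even_eq)
  next
    case False
    then have L: "frac \<tau> > 1/2" using \<tau>(2) by simp
    have "characteristic_poly \<tau> d = [:-1, 1:] * ((monom 1 (k + 1) + [:a:])\<^sup>2 - monom 1 (2 * k + 1))"
      unfolding characteristic_poly_def det_2 floquet_matrix_large[OF \<tau>(1) L, of d, folded k_def a_def]
      by (intro poly_ext, simp only: poly_add poly_diff poly_mult poly_power poly_monom poly_pCons poly_0 pw)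
        (rule id2)
    from q[OF this] have "(z ^ k * z + a)\<^sup>2 - z ^ k * z ^ k * z = 0"
      by (simp only: poly_add poly_diff poly_power poly_monom poly_pCons poly_0 pw mult_1_left mult_zero_right add_0_right)
    \<comment> \<open>The same factorization with the odd exponent \<open>2 * k + 1\<close>, hence
      the leading minus sign in the factor for \<open>-\<mu>\<close>.\<close>
    then have "(m\<^sup>2 * \<mu> * (1 - \<mu>) - a) * (- (m\<^sup>2 * \<mu>) * (1 + \<mu>) - a) = 0"
      unfolding zk unfolding z\<mu> by algebra
    then show False using neq[of "2 * k + 1" 1] neq[of "2 * k + 1" "-1"]
      by (simp add: m_def mult_ac flip: power_even_eq)
  qed
qed

section \<open>Absolute continuity, the triangle wave and sine estimates\<close>

lemma lipschitz_imp_absolutely_continuous: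
  fixes f :: "real \<Rightarrow> real"
  assumes lip: "\<And>x y. \<bar>f y - f x\<bar> \<le> L * \<bar>y - x\<bar>"
  shows "absolutely_continuous_fun_on S f"
  unfolding absolutely_continuous_fun_on_def
proof (intro allI impI)
  fix \<epsilon> :: real assume e: "\<epsilon> > 0"
  have L: "L \<ge> 0" using lip[of 0 1] by (auto intro: order_trans[OF abs_ge_zero])
  show "\<exists>\<delta>>0. \<forall>\<D>. \<D> division_of \<Union>\<D> \<longrightarrow> \<Union>\<D> \<subseteq> S \<longrightarrow>
        (\<Sum>K\<in>\<D>. Sup K - Inf K) < \<delta> \<longrightarrow> (\<Sum>K\<in>\<D>. \<bar>f (Sup K) - f (Inf K)\<bar>) < \<epsilon>"
  \<comment> \<open>Dividing by \<open>L + 1\<close> instead of \<open>L\<close> also covers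
    \<open>L = 0\<close>.\<close>
  proof (intro exI[of _ "\<epsilon> / (L + 1)"] conjI allI impI)
    show "\<epsilon> / (L + 1) > 0" using e L by simp
    fix \<D> :: "real set set"
    assume div: "\<D> division_of \<Union>\<D>" and small: "(\<Sum>K\<in>\<D>. Sup K - Inf K) < \<epsilon> / (L + 1)"
    have len: "0 \<le> Sup K - Inf K" if "K \<in> \<D>" for K
      using division_ofD(3,4)[OF div that] by auto
    have "(\<Sum>K\<in>\<D>. \<bar>f (Sup K) - f (Inf K)\<bar>) \<le> (\<Sum>K\<in>\<D>. (L + 1) * (Sup K - Inf K))"
    proof (rule sum_mono)
      fix K assume "K \<in> \<D>"
      with len[of K] lip[of "Sup K" "Inf K"]
      show "\<bar>f (Sup K) - f (Inf K)\<bar> \<le> (L + 1) * (Sup K - Inf K)"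
        by (simp add: algebra_simps)
    qed
    also have "\<dots> = (L + 1) * (\<Sum>K\<in>\<D>. Sup K - Inf K)"
      by (simp add: sum_distrib_left)
    also have "\<dots> < \<epsilon>" using small L by (simp add: field_simps)
    finally show "(\<Sum>K\<in>\<D>. \<bar>f (Sup K) - f (Inf K)\<bar>) < \<epsilon>" .
  qed
qed

lemma absolutely_continuous_fun_on_diff:
  assumes "absolutely_continuous_fun_on S f" "absolutely_continuous_fun_on S g"
  shows "absolutely_continuous_fun_on S (\<lambda>t. f t - g t)"
  unfolding absolutely_continuous_fun_on_def
proof (intro allI impI)
  fix \<epsilon> :: real assume "\<epsilon> > 0"
  then have e: "\<epsilon> / 2 > 0" by simp
  obtain d1 where d1: "d1 > 0" "\<And>\<D>. \<D> division_of \<Union>\<D> \<Longrightarrow> \<Union>\<D> \<subseteq> S \<Longrightarrow>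
        (\<Sum>K\<in>\<D>. Sup K - Inf K) < d1 \<Longrightarrow> (\<Sum>K\<in>\<D>. \<bar>f (Sup K) - f (Inf K)\<bar>) < \<epsilon> / 2"
    using assms(1) e unfolding absolutely_continuous_fun_on_def by meson
  obtain d2 where d2: "d2 > 0" "\<And>\<D>. \<D> division_of \<Union>\<D> \<Longrightarrow> \<Union>\<D> \<subseteq> S \<Longrightarrow>
        (\<Sum>K\<in>\<D>. Sup K - Inf K) < d2 \<Longrightarrow> (\<Sum>K\<in>\<D>. \<bar>g (Sup K) - g (Inf K)\<bar>) < \<epsilon> / 2"
    using assms(2) e unfolding absolutely_continuous_fun_on_def by meson
  show "\<exists>\<delta>>0. \<forall>\<D>. \<D> division_of \<Union>\<D> \<longrightarrow> \<Union>\<D> \<subseteq> S \<longrightarrow> (\<Sum>K\<in>\<D>. Sup K - Inf K) < \<delta> \<longrightarrow>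
      (\<Sum>K\<in>\<D>. \<bar>f (Sup K) - g (Sup K) - (f (Inf K) - g (Inf K))\<bar>) < \<epsilon>"
  proof (intro exI[of _ "min d1 d2"] conjI allI impI)
    show "min d1 d2 > 0" using d1 d2 by simp
    fix \<D> :: "real set set"
    assume \<D>: "\<D> division_of \<Union>\<D>" "\<Union>\<D> \<subseteq> S" "(\<Sum>K\<in>\<D>. Sup K - Inf K) < min d1 d2"
    have "(\<Sum>K\<in>\<D>. \<bar>f (Sup K) - g (Sup K) - (f (Inf K) - g (Inf K))\<bar>)
        \<le> (\<Sum>K\<in>\<D>. \<bar>f (Sup K) - f (Inf K)\<bar> + \<bar>g (Sup K) - g (Inf K)\<bar>)"
      by (rule sum_mono) linarith
    also have "\<dots> < \<epsilon>" using d1(2)[OF \<D>(1,2)] d2(2)[OF \<D>(1,2)] \<D>(3) by (simp add: sum.distrib)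
    finally show "(\<Sum>K\<in>\<D>. \<bar>f (Sup K) - g (Sup K) - (f (Inf K) - g (Inf K))\<bar>) < \<epsilon>" .
  qed
qed

text \<open>\<open>arccos (cos x)\<close> is the distance from \<open>x\<close> to the nearest
  multiple of \<open>2 * pi\<close>, a triangle wave. Folding into \<open>[0, pi]\<close> keeps
  cosines and replaces sines by their absolute values, so it can only increase the cosine of the
  difference, and cosine decreases on \<open>[0, pi]\<close>.\<close>

lemma abs_arccos_cos_diff_le:
  fixes x y :: real
  shows "\<bar>arccos (cos x) - arccos (cos y)\<bar> \<le> \<bar>x - y\<bar>"
proof (cases "\<bar>x - y\<bar> \<le> pi")
  case True
  define u v where "u = arccos (cos x)" and "v = arccos (cos y)"
  have u: "0 \<le> u" "u \<le> pi" "cos u = cos x" "sin u = \<bar>sin x\<bar>"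
    by (auto simp: u_def arccos_lbound arccos_ubound sin_arccos sin_squared_eq [symmetric])
  have v: "0 \<le> v" "v \<le> pi" "cos v = cos y" "sin v = \<bar>sin y\<bar>"
    by (auto simp: v_def arccos_lbound arccos_ubound sin_arccos sin_squared_eq [symmetric])
  have "cos (x - y) \<le> cos (u - v)"
    using abs_ge_self[of "sin x * sin y"] by (simp add: cos_diff u v abs_mult)
  then have "cos \<bar>x - y\<bar> \<le> cos \<bar>u - v\<bar>" by simp
  then show ?thesis using True u v
    by (subst (asm) cos_mono_le_eq) (auto simp: u_def v_def)
next
  case False
  then show ?thesis
    using arccos_lbound[of "cos x"] arccos_ubound[of "cos x"] arccos_lbound[of "cos y"] arccos_ubound[of "cos y"]
    by auto
qed

lemma has_real_derivative_arccos_cos: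
  assumes "sin x \<noteq> 0"
  shows "((\<lambda>x. arccos (cos x)) has_real_derivative sgn (sin x)) (at x)"
proof -
  have "(cos x)\<^sup>2 < 1" using assms by (simp add: cos_squared_eq)
  then have "-1 < cos x" "cos x < 1"
    by (auto simp: abs_square_less_1)
  then have "((\<lambda>x. arccos (cos x)) has_real_derivative inverse (- sqrt (1 - (cos x)\<^sup>2)) * - sin x) (at x)"
    by (intro DERIV_chain2[OF DERIV_arccos] DERIV_cos)
  moreover have "inverse (- sqrt (1 - (cos x)\<^sup>2)) * - sin x = sgn (sin x)"
    using assms by (simp add: sin_squared_eq [symmetric] sgn_real_def field_simps)
  ultimately show ?thesis by simp
qed

lemma periodic_add_of_int:
  fixes f :: "real \<Rightarrow> 'a"
  assumes "\<And>t. f (t + 1) = f t"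
  shows "f (t + of_int m) = f t"
proof (induction m rule: int_induct[where k = 0])
  case (step1 i)
  then show ?case using assms[of "t + of_int i"] by (simp add: add.assoc)
next
  case (step2 i)
  then show ?case using assms[of "t + of_int (i - 1)"] by (simp add: add.assoc)
qed simp

lemma sin_2pi_add_of_int: "sin (2 * pi * (t + of_int m)) = sin (2 * pi * t)"
proof (rule periodic_add_of_int)
  show "sin (2 * pi * (t + 1)) = sin (2 * pi * t)" for t
    using sin_periodic[of "2 * pi * t"] by (simp add: algebra_simps)
qed

lemma sin_2pi_eq_0_iff: "sin (2 * pi * x) = 0 \<longleftrightarrow> (\<exists>n::int. x = of_int n / 2)"
proof -
  have "2 * pi * x = of_int n * pi \<longleftrightarrow> x = of_int n / 2" for n :: int
  proof -
    have "2 * pi * x = of_int n * pi \<longleftrightarrow> pi * (2 * x) = pi * of_int n"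
      by (simp add: mult_ac)
    also have "\<dots> \<longleftrightarrow> x = of_int n / 2" by auto
    finally show ?thesis .
  qed
  then show ?thesis by (simp add: sin_zero_iff_int2)
qed

lemma abs_sin_diff_le:
  fixes x y :: real
  shows "\<bar>sin x - sin y\<bar> \<le> \<bar>x - y\<bar>"
proof -
  have "norm (sin x - sin y) \<le> 1 * norm (x - y)"
    by (rule field_differentiable_bound[of UNIV sin cos]) (auto intro: DERIV_sin)
  then show ?thesis by simp
qed

lemma scaled_sin_lipschitz:
  fixes c x y :: real
  assumes c: "c \<ge> 0"
  shows "\<bar>c / (2 * pi) * sin (2 * pi * y) - c / (2 * pi) * sin (2 * pi * x)\<bar> \<le> c * \<bar>y - x\<bar>"
proof -
  have "\<bar>c / (2 * pi) * sin (2 * pi * y) - c / (2 * pi) * sin (2 * pi * x)\<bar>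
      = c / (2 * pi) * \<bar>sin (2 * pi * y) - sin (2 * pi * x)\<bar>"
    unfolding right_diff_distrib[symmetric] abs_mult using c by simp
  also have "\<dots> \<le> c / (2 * pi) * \<bar>2 * pi * y - 2 * pi * x\<bar>"
    using c by (intro mult_left_mono abs_sin_diff_le) auto
  also have "\<dots> = c * \<bar>y - x\<bar>"
    unfolding right_diff_distrib[symmetric] abs_mult by simp
  finally show ?thesis .
qed

section \<open>Sign pattern of the forced oscillation and its consequences\<close>

text \<open>Two overlapping regimes cover half a period. On \<open>[1/12, 5/12]\<close> the sine
  part is at least \<open>1/pi\<close>, which beats the bound 1/4 on \<open>g\<close>; on
  \<open>[-1/6, 1/6]\<close> its slope is at least 2, which beats the Lipschitz constant 1 of
  \<open>g\<close>. Antisymmetry supplies the other half.\<close>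

lemma forced_sine_sign:
  fixes g h :: "real \<Rightarrow> real"
  assumes c: "c \<ge> 4" and h: "\<And>t. h t = c / (2 * pi) * sin (2 * pi * t) + g t"
    and lip: "\<And>x y. \<bar>g y - g x\<bar> \<le> \<bar>y - x\<bar>" and anti: "\<And>t. g (t + 1/2) = - g t"
    and \<alpha>: "\<alpha> \<in> {-1/4..1/4}" "h \<alpha> = 0"
  shows "sgn (h t) = sgn (sin (2 * pi * (t - \<alpha>)))" and "cos (2 * pi * \<alpha>) \<ge> 1/2"
proof -
  have cos_ge: "cos (2 * pi * x) \<ge> 1/2" if "\<bar>x\<bar> \<le> 1/6" for x
  proof -
    have "cos (pi / 3) \<le> cos \<bar>2 * pi * x\<bar>"
      using that by (intro cos_monotone_0_pi_le) (auto simp: abs_mult field_simps)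
    then show ?thesis by (simp add: cos_60)
  qed
  have sin_ge: "sin (2 * pi * x) \<ge> 1/2" if x: "x \<in> {1/12..5/12}" for x
  proof -
    have "\<bar>x - 1/4\<bar> \<le> 1/6" using x unfolding atLeastAtMost_iff by arith
    from cos_ge[OF this] show ?thesis by (simp add: cos_diff right_diff_distrib)
  qed
  have h_half: "h (t + 1/2) = - h t" for t
    using sin_periodic_pi[of "2 * pi * t"] by (simp add: h anti distrib_left)
  have g_le: "\<bar>g t\<bar> \<le> 1/4" for t
    using lip[where x = t and y = "t + 1/2"] anti[of t] by simp
  have pos_mid: "h t > 0" if "t \<in> {1/12..5/12}" for t
  proof -
    have "4 / (2 * pi) * (1/2) \<le> c / (2 * pi) * sin (2 * pi * t)"
      using c sin_ge[OF that] by (intro mult_mono divide_right_mono) auto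
    moreover have "4 / (2 * pi) * (1/2) > (1/4 :: real)" using pi_less_4 by (simp add: field_simps)
    ultimately show ?thesis using g_le[of t] unfolding h by linarith
  qed
  have inc: "h x < h y" if xy: "-1/6 \<le> x" "x < y" "y \<le> 1/6" for x y
  proof -
    have "\<exists>z. x < z \<and> z < y \<and> sin (2 * pi * y) - sin (2 * pi * x) = (y - x) * (cos (2 * pi * z) * (2 * pi))"
      using xy(2) by (intro MVT2) (auto intro!: derivative_eq_intros)
    then obtain z where z: "x < z" "z < y"
      "sin (2 * pi * y) - sin (2 * pi * x) = (y - x) * (cos (2 * pi * z) * (2 * pi))" by blast
    have "c / (2 * pi) * sin (2 * pi * y) - c / (2 * pi) * sin (2 * pi * x) = c * cos (2 * pi * z) * (y - x)"
      unfolding right_diff_distrib[symmetric] z(3) by simp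
    also have "\<dots> \<ge> 4 * (1/2) * (y - x)"
      using c cos_ge[of z] z xy by (intro mult_right_mono mult_mono) auto
    finally have "h y - h x - (g y - g x) \<ge> 2 * (y - x)" by (simp add: h)
    moreover have "x - y \<le> g y - g x" using lip[where x = x and y = y] xy(2) by (simp add: abs_le_iff)
    ultimately have "y - x \<le> h y - h x" by (simp only: diff_le_eq le_diff_eq) simp
    with xy(2) show ?thesis by simp
  qed
  \<comment> \<open>\<open>h\<close> is positive on \<open>[1/12, 5/12]\<close> and by antisymmetry
    negative on \<open>[-5/12, -1/12]\<close>, so a zero in \<open>[-1/4, 1/4]\<close> must lie in
    the gap.\<close>
  have \<alpha>12: "-1/12 < \<alpha>" "\<alpha> < 1/12"
    using pos_mid[of \<alpha>] pos_mid[of "\<alpha> + 1/2"] \<alpha> h_half[of \<alpha>] by fastforce+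
  show "cos (2 * pi * \<alpha>) \<ge> 1/2" using cos_ge[of \<alpha>] \<alpha>12 by simp
  have pos: "h t > 0" if t: "\<alpha> < t" "t < \<alpha> + 1/2" for t
  proof -
    consider "t \<le> 1/6" | "t \<in> {1/12..5/12}" | "t > 5/12" by fastforce
    then show ?thesis
    proof cases
      case 1
      then show ?thesis using inc[of \<alpha> t] \<alpha> \<alpha>12 t by simp
    next
      case 3
      then show ?thesis using inc[of "t - 1/2" \<alpha>] h_half[of "t - 1/2"] \<alpha> \<alpha>12 t by simp
    qed (rule pos_mid)
  qed
  define r where "r = frac (t - \<alpha>)"
  have h1: "h (t + 1) = h t" for t using h_half[of t] h_half[of "t + 1/2"] by (simp add: add.assoc)
  have t: "t = \<alpha> + r + of_int \<lfloor>t - \<alpha>\<rfloor>" by (simp add: r_def frac_def)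
  have hr: "h t = h (\<alpha> + r)" by (subst t) (rule periodic_add_of_int[of h, OF h1])
  have sr: "sin (2 * pi * (t - \<alpha>)) = sin (2 * pi * r)"
    using sin_2pi_add_of_int[of r "\<lfloor>t - \<alpha>\<rfloor>"] by (simp add: r_def frac_def)
  have r: "0 \<le> r" "r < 1" by (auto simp: r_def frac_lt_1)
  consider "r = 0" | "r = 1/2" | "0 < r" "r < 1/2" | "1/2 < r" using r by linarith
  then show "sgn (h t) = sgn (sin (2 * pi * (t - \<alpha>)))"
  proof cases
    case 3
    then have "sin (2 * pi * r) > 0" by (intro sin_gt_zero) auto
    moreover have "h (\<alpha> + r) > 0" using 3 by (intro pos) auto
    ultimately show ?thesis by (simp add: hr sr)
  next
    case 4
    then have "sin (2 * pi * r) < 0" using r by (intro sin_lt_zero) auto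
    moreover have "h (\<alpha> + r - 1/2) > 0" using 4 r by (intro pos) auto
    then have "h (\<alpha> + r) < 0" using h_half[of "\<alpha> + r - 1/2"] by simp
    ultimately show ?thesis by (simp add: hr sr)
  next
    case 2
    then show ?thesis using \<alpha> h_half[of \<alpha>] unfolding hr sr 2 by simp
  qed (use \<alpha> in \<open>auto simp: hr sr\<close>)
qed

text \<open>The sign pattern fixes the zeros as the points \<open>\<alpha> + n/2\<close>, upward for
  even \<open>n\<close> and downward for odd \<open>n\<close>. A period below 1 would carry the zero
  \<open>\<alpha>\<close> to another zero, so it would be 1/2, which antisymmetry forbids.\<close>

lemma one_one_periodic_orbit_if_sign:
  assumes sol: "dde_solution \<tau> c h" and half: "\<And>t. h (t + 1/2) = - h t"
    and sign: "\<And>t. sgn (h t) = sgn (sin (2 * pi * (t - \<alpha>)))"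
  shows "one_one_periodic_orbit \<tau> c h \<alpha>"
proof -
  have h1: "h (t + 1) = h t" for t using half[of t] half[of "t + 1/2"] by (simp add: add.assoc)
  have zero: "h t = 0 \<longleftrightarrow> (\<exists>n::int. t = \<alpha> + of_int n / 2)" for t
  proof -
    have "h t = 0 \<longleftrightarrow> sin (2 * pi * (t - \<alpha>)) = 0" using sign[of t] by (metis sgn_0_0)
    also have "\<dots> \<longleftrightarrow> (\<exists>n::int. t = \<alpha> + of_int n / 2)"
      by (simp only: sin_2pi_eq_0_iff diff_eq_eq add.commute)
    finally show ?thesis .
  qed
  have pos: "h (\<alpha> + s) > 0" if "0 < s" "s < 1/2" for s
  proof -
    have "sin (2 * pi * s) > 0" using that by (intro sin_gt_zero) auto
    then show ?thesis using sign[of "\<alpha> + s"] by (simp add: sgn_1_pos)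
  qed
  have neg: "h (\<alpha> - s) < 0" if "0 < s" "s < 1/2" for s
    using pos[of "1/2 - s"] half[of "\<alpha> - s"] that by (simp add: algebra_simps)
  have "has_prime_period 1 h"
    unfolding has_prime_period_def
  proof (intro conjI allI impI notI)
    fix q :: real assume q: "0 < q \<and> q < 1" and per: "\<forall>t. h (t + q) = h t"
    have "h \<alpha> = 0" using zero[of \<alpha>] by (auto intro: exI[of _ 0])
    then have "h (\<alpha> + q) = 0" using per by simp
    then obtain n :: int where n: "q = of_int n / 2" using zero by auto
    then have "n = 1" using q by simp
    then have "q = 1/2" using n by simp
    then have "h (\<alpha> + 1/4 + 1/2) = h (\<alpha> + 1/4)" using per by blast
    then show False using half[of "\<alpha> + 1/4"] pos[of "1/4"] by simp
  qed (auto simp: h1)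
  moreover have "finite {t \<in> {0..<1}. h t = 0}"
  proof (rule finite_subset)
    show "{t \<in> {0..<1}. h t = 0} \<subseteq> (\<lambda>n::int. \<alpha> + of_int n / 2) ` {\<lfloor>- 2 * \<alpha>\<rfloor>..\<lceil>2 * (1 - \<alpha>)\<rceil>}"
    proof (rule subsetI)
      fix t assume "t \<in> {t \<in> {0..<1}. h t = 0}"
      then have t: "0 \<le> t" "t < 1" "h t = 0" by auto
      then obtain n :: int where "t = \<alpha> + of_int n / 2" using zero by auto
      moreover from this t have "\<lfloor>- 2 * \<alpha>\<rfloor> \<le> n" "n \<le> \<lceil>2 * (1 - \<alpha>)\<rceil>"
        by (simp_all add: floor_le_iff le_ceiling_iff)
      ultimately show "t \<in> (\<lambda>n::int. \<alpha> + of_int n / 2) ` {\<lfloor>- 2 * \<alpha>\<rfloor>..\<lceil>2 * (1 - \<alpha>)\<rceil>}" by auto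
    qed
  qed simp
  moreover have "upward_crossing h t \<longleftrightarrow> t \<in> range (\<lambda>n::int. \<alpha> + of_int n)" for t
  proof
    assume up: "upward_crossing h t"
    then obtain n :: int where n: "t = \<alpha> + of_int n / 2" using zero by (auto simp: upward_crossing_def)
    have "even n"
    proof (rule ccontr)
      assume "odd n"
      then obtain m where m: "n = 2 * m + 1" by (elim oddE)
      have "h s > 0" if s: "s \<in> {t - 1/2<..<t}" for s
        using pos[of "s - t + 1/2"] periodic_add_of_int[of h "\<alpha> + (s - t + 1/2)" m, OF h1] s
        by (simp add: n m add_divide_distrib)
      then have "\<forall>\<^sub>F s in at_left t. h s > 0" by (rule eventually_at_leftI) auto
      moreover have "\<forall>\<^sub>F s in at_left t. h s < 0" using up by (simp add: upward_crossing_def)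
      ultimately have "\<forall>\<^sub>F s in at_left t. False" by eventually_elim simp
      then show False by simp
    qed
    then show "t \<in> range (\<lambda>n::int. \<alpha> + of_int n)" using n by (auto elim!: evenE)
  next
    assume "t \<in> range (\<lambda>n::int. \<alpha> + of_int n)"
    then obtain m :: int where t: "t = \<alpha> + of_int m" by auto
    have shift: "h (s + of_int m) = h s" for s by (rule periodic_add_of_int[of h, OF h1])
    have "h t = 0" using zero[of t] t by (auto intro!: exI[of _ "2 * m"])
    moreover have "\<forall>\<^sub>F s in at_left t. h s < 0"
    proof (rule eventually_at_leftI)
      fix s assume "s \<in> {t - 1/2<..<t}"
      then show "h s < 0" using neg[of "t - s"] shift[of "\<alpha> - (t - s)"] by (simp add: t)
    qed simp
    moreover have "\<forall>\<^sub>F s in at_right t. h s > 0"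
    proof (rule eventually_at_rightI)
      fix s assume "s \<in> {t<..<t + 1/2}"
      then show "h s > 0" using pos[of "s - t"] shift[of "\<alpha> + (s - t)"] by (simp add: t)
    qed simp
    ultimately show "upward_crossing h t" by (simp add: upward_crossing_def)
  qed
  ultimately show ?thesis using sol by (auto simp: one_one_periodic_orbit_def)
qed

section \<open>Construction of the symmetric orbit\<close>

lemma symmetric_orbit_exists:
  assumes c: "c \<ge> 4"
  shows "\<exists>h \<alpha>. \<alpha> \<in> {-1/4..1/4} \<and> one_one_periodic_orbit \<tau> c h \<alpha> \<and> symmetric_orbit h"
proof -
  \<comment> \<open>\<open>\<beta>\<close> is the value of \<open>sin (2 * pi * \<alpha>)\<close>
    that solves \<open>h \<alpha> = 0\<close>, since \<open>g \<alpha>\<close> depends only on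
    \<open>\<tau>\<close>.\<close>
  define \<beta> where "\<beta> = (arccos (cos (2 * pi * \<tau>)) - pi / 2) / c"
  define \<alpha> where "\<alpha> = arcsin \<beta> / (2 * pi)"
  \<comment> \<open>The triangle wave with slope
    \<open>- sgn (sin (2 * pi * (t - \<tau> - \<alpha>)))\<close>, centred by 1/4 to be
    antisymmetric. Its slope anticipates the sign pattern of \<open>h\<close>, which
    \<open>forced_sine_sign\<close> then confirms.\<close>
  define g where "g t = 1/4 - arccos (cos (2 * pi * (t - \<tau> - \<alpha>))) / (2 * pi)" for t
  define h where "h t = c / (2 * pi) * sin (2 * pi * t) + g t" for t
  have "\<bar>arccos (cos (2 * pi * \<tau>)) - pi / 2\<bar> \<le> pi / 2"
    using arccos_lbound[of "cos (2 * pi * \<tau>)"] arccos_ubound[of "cos (2 * pi * \<tau>)"]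
    by (intro abs_leI) auto
  also have "pi / 2 \<le> c" using c pi_less_4 by simp
  finally have \<beta>: "-1 \<le> \<beta>" "\<beta> \<le> 1" using c by (auto simp: \<beta>_def abs_le_iff field_simps)
  have \<alpha>: "\<alpha> \<in> {-1/4..1/4}"
    using arcsin_bounded[OF \<beta>] by (auto simp: \<alpha>_def field_simps)
  have "sin (2 * pi * \<alpha>) = \<beta>" using \<beta> by (simp add: \<alpha>_def)
  then have h\<alpha>: "h \<alpha> = 0" using c by (simp add: h_def g_def \<beta>_def field_simps)
  have lip: "\<bar>g y - g x\<bar> \<le> \<bar>y - x\<bar>" for x y
  proof -
    have "\<bar>g y - g x\<bar> = \<bar>arccos (cos (2 * pi * (x - \<tau> - \<alpha>))) - arccos (cos (2 * pi * (y - \<tau> - \<alpha>)))\<bar> / (2 * pi)"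
      by (simp add: g_def flip: diff_divide_distrib)
    also have "\<dots> \<le> \<bar>2 * pi * (x - \<tau> - \<alpha>) - 2 * pi * (y - \<tau> - \<alpha>)\<bar> / (2 * pi)"
      by (intro divide_right_mono abs_arccos_cos_diff_le) simp
    also have "2 * pi * (x - \<tau> - \<alpha>) - 2 * pi * (y - \<tau> - \<alpha>) = 2 * pi * (x - y)"
      by (simp add: algebra_simps)
    finally show ?thesis by (simp add: abs_mult abs_minus_commute)
  qed
  have anti: "g (t + 1/2) = - g t" for t
  proof -
    have "2 * pi * (t + 1/2 - \<tau> - \<alpha>) = 2 * pi * (t - \<tau> - \<alpha>) + pi" by (simp add: algebra_simps)
    then have "cos (2 * pi * (t + 1/2 - \<tau> - \<alpha>)) = - cos (2 * pi * (t - \<tau> - \<alpha>))"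
      by (simp only: cos_periodic_pi)
    then show ?thesis by (simp add: g_def arccos_minus diff_divide_distrib)
  qed
  have half: "h (t + 1/2) = - h t" for t
    using sin_periodic_pi[of "2 * pi * t"] by (simp add: h_def anti distrib_left)
  have sign: "sgn (h t) = sgn (sin (2 * pi * (t - \<alpha>)))" for t
    by (rule forced_sine_sign(1)[OF c h_def lip anti \<alpha> h\<alpha>])
  have deriv: "(h has_real_derivative (- sgn (h (t - \<tau>)) + c * cos (2 * pi * t))) (at t)"
    if "sin (2 * pi * (t - \<tau> - \<alpha>)) \<noteq> 0" for t
  proof -
    have "((\<lambda>t. 2 * pi * (t - \<tau> - \<alpha>)) has_real_derivative 2 * pi) (at t)"
      by (auto intro!: derivative_eq_intros)
    note arccos_deriv = DERIV_chain2[OF has_real_derivative_arccos_cos[OF that] this]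
    have "((\<lambda>t. 2 * pi * t) has_real_derivative 2 * pi) (at t)"
      by (auto intro!: derivative_eq_intros)
    note sin_deriv = DERIV_chain2[OF DERIV_sin this]
    have "(h has_real_derivative c / (2 * pi) * (cos (2 * pi * t) * (2 * pi))
        + (0 - sgn (sin (2 * pi * (t - \<tau> - \<alpha>))) * (2 * pi) / (2 * pi))) (at t)"
      unfolding h_def[abs_def] g_def
      by (intro DERIV_add DERIV_cmult sin_deriv DERIV_diff DERIV_const DERIV_cdivide arccos_deriv)
    then show ?thesis by (simp add: sign)
  qed
  \<comment> \<open>The corners of the triangle wave, where the differential equation may
    fail.\<close>
  have "countable {t. sin (2 * pi * (t - \<tau> - \<alpha>)) = 0}"
  proof (rule countable_subset)
    show "{t. sin (2 * pi * (t - \<tau> - \<alpha>)) = 0} \<subseteq> range (\<lambda>n::int. \<tau> + \<alpha> + of_int n / 2)"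
    proof (rule subsetI)
      fix t assume "t \<in> {t. sin (2 * pi * (t - \<tau> - \<alpha>)) = 0}"
      then obtain n :: int where "t - \<tau> - \<alpha> = of_int n / 2" unfolding sin_2pi_eq_0_iff by auto
      then have "t = \<tau> + \<alpha> + of_int n / 2" by simp
      then show "t \<in> range (\<lambda>n::int. \<tau> + \<alpha> + of_int n / 2)" by blast
    qed
  qed simp
  then have "{t. sin (2 * pi * (t - \<tau> - \<alpha>)) = 0} \<in> null_sets lebesgue"
    by (intro null_sets_completionI countable_imp_null_set_lborel)
  then have "AE t in lebesgue. (h has_real_derivative (- sgn (h (t - \<tau>)) + c * cos (2 * pi * t))) (at t)"
    by (rule AE_I') (use deriv in auto)
  moreover have "absolutely_continuous_fun_on S h" for S
  proof (rule lipschitz_imp_absolutely_continuous)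
    fix x y
    have "\<bar>c / (2 * pi) * sin (2 * pi * y) - c / (2 * pi) * sin (2 * pi * x)\<bar> \<le> c * \<bar>y - x\<bar>"
      using c by (intro scaled_sin_lipschitz) simp
    moreover have "h y - h x = (c / (2 * pi) * sin (2 * pi * y) - c / (2 * pi) * sin (2 * pi * x)) + (g y - g x)"
      by (simp add: h_def)
    ultimately show "\<bar>h y - h x\<bar> \<le> (c + 1) * \<bar>y - x\<bar>"
      using lip[of y x] by (simp add: distrib_right)
  qed
  ultimately have "dde_solution \<tau> c h"
    by (simp add: dde_solution_def locally_absolutely_continuous_def)
  then have "one_one_periodic_orbit \<tau> c h \<alpha>"
    using half sign by (rule one_one_periodic_orbit_if_sign)
  moreover have "symmetric_orbit h" by (simp add: symmetric_orbit_def half)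
  ultimately show ?thesis using \<alpha> by blast
qed

section \<open>Slope of an arbitrary symmetric orbit at its upward crossing\<close>

text \<open>Compares a solution with a smooth \<open>k\<close>. With \<open>L = 1\<close> and the
  sine part it makes the remainder 1-Lipschitz; with \<open>L = 0\<close> it identifies the solution
  up to a constant wherever the delayed sign is constant.\<close>

lemma dde_solution_minus_lipschitz_bound:
  assumes sol: "dde_solution \<tau> c h" and ab: "a \<le> b" and L: "0 \<le> L"
    and k: "\<And>t. (k has_real_derivative k' t) (at t)" "\<And>x y. \<bar>k y - k x\<bar> \<le> M * \<bar>y - x\<bar>"
    and bound: "\<And>t. t \<in> {a..b} \<Longrightarrow> \<bar>- sgn (h (t - \<tau>)) + c * cos (2 * pi * t) - k' t\<bar> \<le> L"
  shows "\<bar>(h b - k b) - (h a - k a)\<bar> \<le> L * (b - a)"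
proof (rule absolutely_continuous_lipschitz_bound[OF _ ab L])
  show "absolutely_continuous_fun_on {a..b} (\<lambda>t. h t - k t)"
    using sol lipschitz_imp_absolutely_continuous[OF k(2)]
    by (intro absolutely_continuous_fun_on_diff) (auto simp: dde_solution_def locally_absolutely_continuous_def)
  have "AE t in lebesgue. (h has_real_derivative (- sgn (h (t - \<tau>)) + c * cos (2 * pi * t))) (at t)"
    using sol by (simp add: dde_solution_def)
  then show "AE t in lebesgue. t \<in> {a..b} \<longrightarrow>
      (\<exists>D. \<bar>D\<bar> \<le> L \<and> ((\<lambda>t. h t - k t) has_real_derivative D) (at t))"
  proof eventually_elim
    case (elim t)
    then show ?case using DERIV_diff[OF elim k(1)[of t]] bound[of t] by blast
  qed
qed

text \<open>The equation holds only almost everywhere, so differentiability at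
  \<open>\<alpha>\<close> has to be recovered. As \<open>\<tau>\<close> is not a half-integer, the
  delayed sign is constant near \<open>\<alpha>\<close>, and there \<open>h\<close> coincides with a
  smooth function.\<close>

lemma symmetric_orbit_deriv_ge:
  assumes c: "c \<ge> 4" and \<alpha>: "\<alpha> \<in> {-1/4..1/4}" and orbit: "one_one_periodic_orbit \<tau> c h \<alpha>"
    and sym: "symmetric_orbit h" and \<tau>: "sin (2 * pi * \<tau>) \<noteq> 0"
  shows "deriv h \<alpha> \<ge> c / 2 - 1"
proof -
  define k where "k t = c / (2 * pi) * sin (2 * pi * t)" for t
  have k: "(k has_real_derivative c * cos (2 * pi * t)) (at t)" for t
    unfolding k_def[abs_def] by (auto intro!: derivative_eq_intros)
  have k_lip: "\<bar>k y - k x\<bar> \<le> c * \<bar>y - x\<bar>" for x y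
    using c unfolding k_def by (intro scaled_sin_lipschitz) simp
  have sol: "dde_solution \<tau> c h" using orbit by (simp add: one_one_periodic_orbit_def)
  have half: "h (t + 1/2) = - h t" for t
    using sym unfolding symmetric_orbit_def by (metis minus_minus)
  have "upward_crossing h \<alpha>"
    using orbit unfolding one_one_periodic_orbit_def by (metis add.right_neutral mem_Collect_eq of_int_0 rangeI)
  then have h\<alpha>: "h \<alpha> = 0" by (simp add: upward_crossing_def)
  define g where "g t = h t - k t" for t
  have lip': "\<bar>g b - g a\<bar> \<le> b - a" if "a \<le> b" for a b
    using dde_solution_minus_lipschitz_bound[OF sol that zero_le_one k k_lip]
    by (simp add: g_def abs_sgn_eq)
  have lip: "\<bar>g b - g a\<bar> \<le> \<bar>b - a\<bar>" for a b
    using lip'[of a b] lip'[of b a] by linarith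
  have anti: "g (t + 1/2) = - g t" for t
    using sin_periodic_pi[of "2 * pi * t"] by (simp add: g_def k_def half distrib_left)
  have h: "h t = c / (2 * pi) * sin (2 * pi * t) + g t" for t by (simp add: g_def k_def)
  note sign = forced_sine_sign[OF c h lip anti \<alpha> h\<alpha>]
  \<comment> \<open>The delayed sign at \<open>t = \<alpha>\<close>, left unsimplified to match the
    phase \<open>t - \<tau> - \<alpha>\<close>.\<close>
  define \<sigma> where "\<sigma> = sgn (sin (2 * pi * (\<alpha> - \<tau> - \<alpha>)))"
  have "isCont (\<lambda>t. sin (2 * pi * (t - \<tau> - \<alpha>)) * \<sigma>) \<alpha>" by (intro continuous_intros)
  moreover have "sin (2 * pi * (\<alpha> - \<tau> - \<alpha>)) * \<sigma> > 0"
    using \<tau> by (simp add: \<sigma>_def sgn_if)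
  ultimately have "\<forall>\<^sub>F t in nhds \<alpha>. sin (2 * pi * (t - \<tau> - \<alpha>)) * \<sigma> > 0"
    using order_tendstoD(1) isCont_def tendsto_at_iff_tendsto_nhds by metis
  then obtain e where e: "e > 0" "\<And>t. dist t \<alpha> < e \<Longrightarrow> sin (2 * pi * (t - \<tau> - \<alpha>)) * \<sigma> > 0"
    unfolding eventually_nhds_metric by blast
  have \<sigma>: "sgn (h (t - \<tau>)) = \<sigma>" if "dist t \<alpha> < e" for t
    using e(2)[OF that] sign(1)[of "t - \<tau>"] by (simp add: \<sigma>_def sgn_if split: if_splits)
  have const: "h b - (k b - \<sigma> * b) = h a - (k a - \<sigma> * a)"
    if "a \<le> b" "dist a \<alpha> < e" "dist b \<alpha> < e" for a b
  proof -
    have "\<bar>(h b - (k b - \<sigma> * b)) - (h a - (k a - \<sigma> * a))\<bar> \<le> 0 * (b - a)"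
    proof (rule dde_solution_minus_lipschitz_bound[OF sol that(1)])
      show "((\<lambda>t. k t - \<sigma> * t) has_real_derivative c * cos (2 * pi * t) - \<sigma>) (at t)" for t
        by (auto intro!: derivative_eq_intros k)
      fix x y
      have "(k y - \<sigma> * y) - (k x - \<sigma> * x) = (k y - k x) - \<sigma> * (y - x)" by (simp add: algebra_simps)
      moreover have "\<bar>\<sigma> * (y - x)\<bar> \<le> \<bar>y - x\<bar>" by (simp add: \<sigma>_def abs_mult abs_sgn_eq)
      ultimately show "\<bar>(k y - \<sigma> * y) - (k x - \<sigma> * x)\<bar> \<le> (c + 1) * \<bar>y - x\<bar>"
        using k_lip[of y x] by (simp add: distrib_right)
    next
      fix t assume "t \<in> {a..b}"
      then have "dist t \<alpha> < e" using that by (simp add: dist_real_def abs_less_iff)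
      then show "\<bar>- sgn (h (t - \<tau>)) + c * cos (2 * pi * t) - (c * cos (2 * pi * t) - \<sigma>)\<bar> \<le> 0"
        by (simp add: \<sigma>)
    qed simp
    then show ?thesis by simp
  qed
  have eq: "(k t - \<sigma> * t) + (h \<alpha> - (k \<alpha> - \<sigma> * \<alpha>)) = h t" if "t \<in> ball \<alpha> e" for t
    using const[of t \<alpha>] const[of \<alpha> t] that e(1) by (cases "t \<le> \<alpha>") (auto simp: dist_commute)
  have "((\<lambda>t. (k t - \<sigma> * t) + (h \<alpha> - (k \<alpha> - \<sigma> * \<alpha>))) has_real_derivative c * cos (2 * pi * \<alpha>) - \<sigma>) (at \<alpha>)"
    by (auto intro!: derivative_eq_intros k)
  then have "(h has_real_derivative c * cos (2 * pi * \<alpha>) - \<sigma>) (at \<alpha>)"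
    by (rule has_field_derivative_transform_within_open[of _ _ _ "ball \<alpha> e"]) (use e eq in auto)
  then have "deriv h \<alpha> = c * cos (2 * pi * \<alpha>) - \<sigma>" by (rule DERIV_imp_deriv)
  moreover have "c * (1/2) \<le> c * cos (2 * pi * \<alpha>)" using sign(2) c by (intro mult_left_mono) auto
  moreover have "\<sigma> \<le> 1" by (simp add: \<sigma>_def sgn_if)
  ultimately show ?thesis by simp
qed

section \<open>Thresholds for the forcing amplitude\<close>

theorem theorem4p4:
  fixes \<tau> :: real
  assumes "\<tau> > 0"
  shows "(\<exists>C>0. \<forall>c>C. \<exists>h \<alpha>. \<alpha> \<in> {-1/4..1/4} \<and>
            one_one_periodic_orbit \<tau> c h \<alpha> \<and> symmetric_orbit h) \<and>
         ((\<forall>j::nat. \<tau> \<noteq> real j / 2) \<longrightarrow>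
            (\<exists>C>0. \<forall>c>C. \<forall>h \<alpha>. \<alpha> \<in> {-1/4..1/4} \<and>
               one_one_periodic_orbit \<tau> c h \<alpha> \<and> symmetric_orbit h \<longrightarrow>
               asymptotically_stable_orbit \<tau> h \<alpha>))"
proof (intro conjI impI)
  show "\<exists>C>0. \<forall>c>C. \<exists>h \<alpha>. \<alpha> \<in> {-1/4..1/4} \<and> one_one_periodic_orbit \<tau> c h \<alpha> \<and> symmetric_orbit h"
    by (intro exI[of _ 4] conjI allI impI symmetric_orbit_exists) auto
next
  assume \<tau>: "\<forall>j::nat. \<tau> \<noteq> real j / 2"
  define k where "k = nat \<lfloor>\<tau>\<rfloor>"
  have k: "of_int \<lfloor>\<tau>\<rfloor> = real k" using assms by (simp add: k_def)
  have frac: "frac \<tau> \<noteq> 1/2"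
    using \<tau>[rule_format, of "2 * k + 1"] by (auto simp: frac_def k field_simps)
  have sin: "sin (2 * pi * \<tau>) \<noteq> 0"
  proof
    assume "sin (2 * pi * \<tau>) = 0"
    then obtain i :: int where i: "\<tau> = of_int i / 2" by (auto simp: sin_2pi_eq_0_iff)
    then have "\<tau> = real (nat i) / 2" using assms by simp
    then show False using \<tau> by blast
  qed
  show "\<exists>C>0. \<forall>c>C. \<forall>h \<alpha>. \<alpha> \<in> {-1/4..1/4} \<and> one_one_periodic_orbit \<tau> c h \<alpha> \<and> symmetric_orbit h \<longrightarrow>
      asymptotically_stable_orbit \<tau> h \<alpha>"
  \<comment> \<open>Chosen so that \<open>c / 2 - 1\<close> exceeds \<open>4 * k + 4\<close>, which
    is the smallness condition \<open>2 / d * (2 * k + 2) < 1\<close> for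
    \<open>d = deriv h \<alpha>\<close>.\<close>
  proof (intro exI[of _ "8 * real k + 10"] conjI allI impI, simp, elim conjE)
    fix c h \<alpha>
    assume c: "8 * real k + 10 < c" and *: "\<alpha> \<in> {-1/4..1/4}" "one_one_periodic_orbit \<tau> c h \<alpha>" "symmetric_orbit h"
    have "c / 2 - 1 \<le> deriv h \<alpha>" using c by (intro symmetric_orbit_deriv_ge[OF _ * sin]) simp
    then have d: "deriv h \<alpha> > 4 * real k + 4" using c by simp
    then have "2 / deriv h \<alpha> * (2 * real k + 2) < 1" by (simp add: field_simps)
    then show "asymptotically_stable_orbit \<tau> h \<alpha>"
      unfolding asymptotically_stable_orbit_def
      using nontrivial_multipliers_norm_less_one[OF assms frac, of "deriv h \<alpha>"] d by (auto simp: k_def)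
  qed
qed

end
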